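(* Let $\mathbb{F}$ be an algebraically closed field with $\mathrm{Char}(\mathbb{F})\ne2$. Let $a_0,a_1,a_2,x_1,x_2,\theta^*_0,\theta^*_1,\theta^*_2\in\mathbb{F}$ and consider the matrices in $\mathrm{Mat}_3(\mathbb{F})$ $$A=\begin{pmatrix}a_0&x_1&0\\1&a_1&x_2\\0&1&a_2\end{pmatrix},\qquad B=\begin{pmatrix}0&x_1&0\\1&0&x_2\\0&1&0\end{pmatrix},\qquad A^*=\mathrm{diag}(\theta^*_0,\theta^*_1,\theta^*_2).$$ Assume that $B,A^*$ is a Leonard pair over $\mathbb{F}$. Then $A,A^*$ is a near-bipartite expansion of $B,A^*$ if and only if one of the following (i), (ii) holds: (i) $a_0=a_2$ and $(a_0-a_1)^2+4(x_1+x_2)\neq0$; (ii) $a_0\neq a_2$ and all of the following hold: $$a_0(\theta^*_0-\theta^*_1)+a_2(\theta^*_1-\theta^*_2)+a_1(\theta^*_2-\theta^*_0)=0,$$ $$(a_0-a_2)^2+4(x_1+x_2)\neq0,\qquad (a_0-a_2)^2+\frac{(x_1+x_2)^3}{x_1x_2}\neq0.$$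
   Context: A tridiagonal matrix is irreducible if all its subdiagonal and superdiagonal entries are nonzero. Let $V$ be a vector space over $\mathbb{F}$ of dimension $d+1$. A Leonard pair on $V$ (over $\mathbb{F}$) is an ordered pair $A,A^*$ in $\mathrm{End}(V)$ such that (a) some basis of $V$ makes the matrix of $A$ irreducible tridiagonal and that of $A^*$ diagonal; (b) some basis of $V$ makes the matrix of $A^*$ irreducible tridiagonal and that of $A$ diagonal. ($A^*$ is just a name, not an adjoint.) Here $V=\mathbb{F}^3$ and matrices act by left multiplication. Each of $A,A^*$ has $d+1$ distinct eigenvalues. Let $E^*_0,\dots,E^*_d$ be the primitive idempotents of $A^*$ (projections onto its eigenspaces along the sum of the other eigenspaces). The flat part of $A$ is $F=\sum_{i=0}^d E^*_i A E^*_i$. $A,A^*$ is bipartite if $F=0$, and near-bipartite if $A-F,A^*$ is a Leonard pair on $V$; in that case $A-F,A^*$ is a bipartite Leonard pair called the bipartite contraction of $A,A^*$. A near-bipartite expansion of a bipartite Leonard pair $B,A^*$ on $V$ is a near-bipartite Leonard pair $A,A^*$ on $V$ whose bipartite contraction equals $B,A^*$. *)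

theory Defs
  imports "HOL-Analysis.Analysis" "HOL-Computational_Algebra.Computational_Algebra"
begin

definition diagonal_matrix :: "nat \<Rightarrow> (nat \<Rightarrow> nat \<Rightarrow> 'a::zero) \<Rightarrow> bool" where
  "diagonal_matrix d M \<longleftrightarrow> (\<forall>i\<le>d. \<forall>j\<le>d. i \<noteq> j \<longrightarrow> M i j = 0)"

definition tridiagonal_matrix :: "nat \<Rightarrow> (nat \<Rightarrow> nat \<Rightarrow> 'a::zero) \<Rightarrow> bool" where
  "tridiagonal_matrix d M \<longleftrightarrow> (\<forall>i\<le>d. \<forall>j\<le>d. Suc i < j \<or> Suc j < i \<longrightarrow> M i j = 0)"

definition irreducible_tridiagonal_matrix :: "nat \<Rightarrow> (nat \<Rightarrow> nat \<Rightarrow> 'a::zero) \<Rightarrow> bool" where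
  "irreducible_tridiagonal_matrix d M \<longleftrightarrow>
     tridiagonal_matrix d M \<and> (\<forall>i<d. M i (Suc i) \<noteq> 0 \<and> M (Suc i) i \<noteq> 0)"

text \<open>Indices run over \<open>0, \<dots>, d\<close>, so the size of a matrix and the
  dimension of the vector space are \<open>d + 1\<close>.\<close>

context vector_space
begin

definition ordered_basis :: "nat \<Rightarrow> (nat \<Rightarrow> 'b) \<Rightarrow> bool" where
  "ordered_basis d b \<longleftrightarrow>
     inj_on b {..d} \<and> independent (b ` {..d}) \<and> span (b ` {..d}) = UNIV"

text \<open>The \<open>j\<close>-th column consists of the coordinates of \<open>T (b j)\<close>.\<close>

definition matrix_wrt :: "nat \<Rightarrow> (nat \<Rightarrow> 'b) \<Rightarrow> ('b \<Rightarrow> 'b) \<Rightarrow> nat \<Rightarrow> nat \<Rightarrow> 'a" where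
  "matrix_wrt d b T i j = representation (b ` {..d}) (T (b j)) (b i)"

text \<open>\<open>leonard_pair d A As\<close> forces the whole space to have dimension \<open>d + 1\<close>,
  through the existence of an ordered basis indexed by \<open>0, \<dots>, d\<close>.\<close>

definition leonard_pair :: "nat \<Rightarrow> ('b \<Rightarrow> 'b) \<Rightarrow> ('b \<Rightarrow> 'b) \<Rightarrow> bool" where
  "leonard_pair d A As \<longleftrightarrow>
     Vector_Spaces.linear scale scale A \<and> Vector_Spaces.linear scale scale As \<and>
     (\<exists>b. local.ordered_basis d b \<and> irreducible_tridiagonal_matrix d (local.matrix_wrt d b A)
        \<and> diagonal_matrix d (local.matrix_wrt d b As)) \<and>
     (\<exists>b. local.ordered_basis d b \<and> irreducible_tridiagonal_matrix d (local.matrix_wrt d b As)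
        \<and> diagonal_matrix d (local.matrix_wrt d b A))"

definition eigenspace :: "('b \<Rightarrow> 'b) \<Rightarrow> 'a \<Rightarrow> 'b set" where
  "eigenspace T \<theta> = {v. T v = scale \<theta> v}"

definition eigenvalues :: "('b \<Rightarrow> 'b) \<Rightarrow> 'a set" where
  "eigenvalues T = {\<theta>. \<exists>v. v \<noteq> 0 \<and> v \<in> local.eigenspace T \<theta>}"

text \<open>The projection onto the eigenspace for \<open>\<theta>\<close> along the sum of the other
  eigenspaces. The description is unique only if \<open>T\<close> is diagonalizable, which holds for
  both members of a Leonard pair.\<close>

definition primitive_idempotent :: "('b \<Rightarrow> 'b) \<Rightarrow> 'a \<Rightarrow> 'b \<Rightarrow> 'b" where
  "primitive_idempotent T \<theta> =
     (THE E. Vector_Spaces.linear scale scale E \<and>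
        (\<forall>v\<in>local.eigenspace T \<theta>. E v = v) \<and>
        (\<forall>\<mu>. \<mu> \<noteq> \<theta> \<longrightarrow> (\<forall>v\<in>local.eigenspace T \<mu>. E v = 0)))"

definition flat_part :: "('b \<Rightarrow> 'b) \<Rightarrow> ('b \<Rightarrow> 'b) \<Rightarrow> 'b \<Rightarrow> 'b" where
  "flat_part A As v =
     (\<Sum>\<theta>\<in>local.eigenvalues As. local.primitive_idempotent As \<theta> (A (local.primitive_idempotent As \<theta> v)))"

definition bipartite_leonard_pair :: "nat \<Rightarrow> ('b \<Rightarrow> 'b) \<Rightarrow> ('b \<Rightarrow> 'b) \<Rightarrow> bool" where
  "bipartite_leonard_pair d A As \<longleftrightarrow> local.leonard_pair d A As \<and> local.flat_part A As = (\<lambda>v. 0)"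

text \<open>The first member of the bipartite contraction; the second member is \<open>As\<close> itself.\<close>

definition bipartite_contraction :: "('b \<Rightarrow> 'b) \<Rightarrow> ('b \<Rightarrow> 'b) \<Rightarrow> 'b \<Rightarrow> 'b" where
  "bipartite_contraction A As = (\<lambda>v. A v - local.flat_part A As v)"

definition near_bipartite_leonard_pair :: "nat \<Rightarrow> ('b \<Rightarrow> 'b) \<Rightarrow> ('b \<Rightarrow> 'b) \<Rightarrow> bool" where
  "near_bipartite_leonard_pair d A As \<longleftrightarrow>
     local.leonard_pair d A As \<and> local.leonard_pair d (local.bipartite_contraction A As) As"

text \<open>\<open>near_bipartite_expansion d A B As\<close>: the pair \<open>A, As\<close> is a near-bipartite expansion
  of the bipartite Leonard pair \<open>B, As\<close>.\<close>

definition near_bipartite_expansion ::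
    "nat \<Rightarrow> ('b \<Rightarrow> 'b) \<Rightarrow> ('b \<Rightarrow> 'b) \<Rightarrow> ('b \<Rightarrow> 'b) \<Rightarrow> bool" where
  "near_bipartite_expansion d A B As \<longleftrightarrow>
     local.bipartite_leonard_pair d B As \<and> local.near_bipartite_leonard_pair d A As \<and>
     local.bipartite_contraction A As = B"

end

end

theory Submission
  imports Defs
begin

text \<open>
  An irreducible tridiagonal \<open>A\<close> is self-adjoint for the bilinear form with Gram matrix
  \<open>diag(1, x\<^sub>1, x\<^sub>1x\<^sub>2)\<close>, as is \<open>A\<^sup>*\<close>. Hence \<open>A, A\<^sup>*\<close> is a Leonard pair iff \<open>A\<close> has three
  distinct eigenvalues and two of its eigenvectors \<open>v, w\<close> satisfy \<open>\<langle>v, A\<^sup>*w\<rangle> = 0\<close>; the remaining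
  off-diagonal entries of \<open>A\<^sup>*\<close> are nonzero because \<open>A\<close> and \<open>A\<^sup>*\<close> have no common eigenvector.
  For \<open>B\<close> this gives \<open>x\<^sub>1(\<theta>\<^sup>*\<^sub>0 - \<theta>\<^sup>*\<^sub>1) = x\<^sub>2(\<theta>\<^sup>*\<^sub>1 - \<theta>\<^sup>*\<^sub>2)\<close>, which turns the condition for \<open>A\<close> into
  \<open>(\<lambda> - a\<^sub>2)(\<mu> - a\<^sub>2) = -(x\<^sub>1 + x\<^sub>2)\<close> for two eigenvalues \<open>\<lambda>, \<mu>\<close>. Evaluating the characteristic
  polynomial at \<open>a\<^sub>2\<close>, the third eigenvalue must be \<open>(x\<^sub>1a\<^sub>2 + x\<^sub>2a\<^sub>0)/(x\<^sub>1 + x\<^sub>2)\<close>, and this number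
  is an eigenvalue iff \<open>a\<^sub>0 = a\<^sub>2\<close> or it equals \<open>a\<^sub>1\<close>.
\<close>

no_notation fps_nth (infixl "$" 75)

section \<open>Coordinates with respect to an ordered basis\<close>

lemma atMost_2: "{..2::nat} = {0, 1, 2}"
  by auto

context vector_space
begin

lemma ordered_basis_sum:
  assumes "ordered_basis d b"
  shows "(\<Sum>v\<in>b ` {..d}. f v) = (\<Sum>i\<le>d. f (b i))"
  using assms by (simp add: ordered_basis_def sum.reindex)

lemma matrix_wrt_expansion:
  assumes "ordered_basis d b"
  shows "T (b j) = (\<Sum>i\<le>d. scale (matrix_wrt d b T i j) (b i))"
proof -
  have "(\<Sum>v\<in>b ` {..d}. scale (representation (b ` {..d}) (T (b j)) v) v) = T (b j)"
    using assms by (intro sum_representation_eq) (auto simp: ordered_basis_def)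
  then show ?thesis
    unfolding ordered_basis_sum[OF assms] by (simp add: matrix_wrt_def)
qed

lemma matrix_wrt_eigenvector:
  assumes "ordered_basis d b" "i \<le> d" "j \<le> d" "T (b j) = scale \<theta> (b j)"
  shows "matrix_wrt d b T i j = (if i = j then \<theta> else 0)"
proof -
  have "independent (b ` {..d})" "inj_on b {..d}" "b j \<in> b ` {..d}"
    using assms by (auto simp: ordered_basis_def)
  then show ?thesis
    using assms
    by (auto simp: matrix_wrt_def representation_scale representation_basis span_base dest: inj_onD)
qed

text \<open>\<open>independent\<close> concerns a set of vectors; injectivity of \<open>b\<close>
  carries coefficients indexed by \<open>i\<close> over to that set.\<close>

lemma ordered_basis_independent:
  assumes "ordered_basis d b" "(\<Sum>i\<le>d. scale (c i) (b i)) = 0" "i \<le> d"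
  shows "c i = 0"
proof -
  have inj: "inj_on b {..d}" and ind: "independent (b ` {..d})"
    using assms by (auto simp: ordered_basis_def)
  define g where "g v = c (the_inv_into {..d} b v)" for v
  have g: "g (b i) = c i" if "i \<le> d" for i
    using inj that by (simp add: g_def the_inv_into_f_f)
  have "(\<Sum>v\<in>b ` {..d}. scale (g v) v) = 0"
    unfolding ordered_basis_sum[OF assms(1)] using assms(2) g by simp
  then have "g (b i) = 0"
    using independentD[OF ind _ subset_refl] assms(3) by blast
  then show ?thesis using g assms(3) by simp
qed

lemma diagonal_matrix_wrt_eigenvector:
  assumes "ordered_basis d b" "diagonal_matrix d (matrix_wrt d b T)" "j \<le> d"
  shows "T (b j) = scale (matrix_wrt d b T j j) (b j)"
proof -
  have "T (b j) = (\<Sum>i\<le>d. if j = i then scale (matrix_wrt d b T i j) (b i) else 0)"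
    unfolding matrix_wrt_expansion[OF assms(1), of T j]
    using assms(2,3) by (intro sum.cong) (auto simp: diagonal_matrix_def)
  then show ?thesis using assms(3) by (simp add: sum.delta)
qed

lemma diagonal_matrix_wrtI:
  assumes "ordered_basis d b" "\<And>j. j \<le> d \<Longrightarrow> T (b j) = scale (\<theta> j) (b j)"
  shows "diagonal_matrix d (matrix_wrt d b T)"
  unfolding diagonal_matrix_def using matrix_wrt_eigenvector[OF assms(1), where T = T] assms(2) by metis

lemma matrix_wrt_2:
  assumes "ordered_basis 2 b"
  shows "T (b j) = scale (matrix_wrt 2 b T 0 j) (b 0) + scale (matrix_wrt 2 b T 1 j) (b 1)
    + scale (matrix_wrt 2 b T 2 j) (b 2)"
  using matrix_wrt_expansion[OF assms, of T j] by (simp add: atMost_2 add.assoc)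

lemma ordered_basis_2_independent:
  assumes "ordered_basis 2 b" "scale p (b 0) + scale q (b 1) + scale r (b 2) = 0"
  shows "p = 0" "q = 0" "r = 0"
proof -
  have *: "(\<Sum>i\<le>2. scale (if i = 0 then p else if i = 1 then q else r) (b i)) = 0"
    using assms(2) by (simp add: atMost_2 add.assoc)
  show "p = 0" "q = 0" "r = 0"
    using ordered_basis_independent[OF assms(1) *, of 0] ordered_basis_independent[OF assms(1) *, of 1]
      ordered_basis_independent[OF assms(1) *, of 2] by auto
qed

lemma irreducible_tridiagonal_2:
  "irreducible_tridiagonal_matrix 2 M \<longleftrightarrow>
     M 0 2 = 0 \<and> M 2 0 = 0 \<and> M 0 1 \<noteq> 0 \<and> M 1 0 \<noteq> 0 \<and> M 1 2 \<noteq> 0 \<and> M 2 1 \<noteq> 0"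
proof -
  have le: "i \<le> 2 \<longleftrightarrow> i = 0 \<or> i = 1 \<or> i = 2" for i :: nat by auto
  have less: "i < 2 \<longleftrightarrow> i = 0 \<or> i = 1" for i :: nat by auto
  show ?thesis
    by (auto simp: irreducible_tridiagonal_matrix_def tridiagonal_matrix_def le less
        simp flip: One_nat_def numeral_2_eq_2)
qed

end

section \<open>Bases of the three-dimensional space\<close>

text \<open>Applied to scalars as well, to list the eigenvalues along a basis. Indices above 2
  repeat the last entry, so the eigenvector equations hold at every index.\<close>

definition basis3 :: "'b \<Rightarrow> 'b \<Rightarrow> 'b \<Rightarrow> nat \<Rightarrow> 'b" where
  "basis3 u0 u1 u2 j = (if j = 0 then u0 else if j = 1 then u1 else u2)"

lemma basis3_simps [simp]:
  "basis3 u0 u1 u2 0 = u0" "basis3 u0 u1 u2 (Suc 0) = u1" "basis3 u0 u1 u2 2 = u2"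
  by (simp_all add: basis3_def)

text \<open>Three independent vectors span by a dimension count; the coefficients 1, -1, 0 in
  \<open>ind\<close> show that they are distinct.\<close>

lemma ordered_basis_basis3:
  fixes u0 u1 u2 :: "'a::field ^ 3"
  assumes ind: "\<And>p q r. p *s u0 + q *s u1 + r *s u2 = 0 \<Longrightarrow> p = 0 \<and> q = 0 \<and> r = 0"
  shows "vec.ordered_basis 2 (basis3 u0 u1 u2)"
proof -
  have ne: "u0 \<noteq> u1" "u0 \<noteq> u2" "u1 \<noteq> u2"
    using ind[of 1 "-1" 0] ind[of 1 0 "-1"] ind[of 0 1 "-1"] by auto
  have im: "basis3 u0 u1 u2 ` {..2} = {u0, u1, u2}"
    by (simp add: atMost_2)
  have indep: "vec.independent {u0, u1, u2}"
  proof (rule vec.independent_if_scalars_zero)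
    fix f x assume "(\<Sum>x\<in>{u0, u1, u2}. f x *s x) = 0" "x \<in> {u0, u1, u2}"
    then show "f x = 0"
      using ind[of "f u0" "f u1" "f u2"] ne by (auto simp: add.assoc)
  qed simp
  have "UNIV \<subseteq> vec.span {u0, u1, u2}"
    using indep ne
    by (intro vec.card_ge_dim_independent) (simp_all add: vec_dim_card del: vec.dim_UNIV)
  moreover have "inj_on (basis3 u0 u1 u2) {..2}"
    using ne by (simp add: atMost_2)
  ultimately show ?thesis
    unfolding vec.ordered_basis_def im using indep by blast
qed

section \<open>The matrices, their eigenvectors and the bilinear form\<close>

definition tridiag3 :: "'a::field \<Rightarrow> 'a \<Rightarrow> 'a \<Rightarrow> 'a \<Rightarrow> 'a \<Rightarrow> 'a ^ 3 ^ 3" where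
  "tridiag3 a0 a1 a2 x1 x2 = vector [vector [a0, x1, 0], vector [1, a1, x2], vector [0, 1, a2]]"

definition diag3 :: "'a::field \<Rightarrow> 'a \<Rightarrow> 'a \<Rightarrow> 'a ^ 3 ^ 3" where
  "diag3 t0 t1 t2 = vector [vector [t0, 0, 0], vector [0, t1, 0], vector [0, 0, t2]]"

lemma tridiag3_mult [simp]:
  "(tridiag3 a0 a1 a2 x1 x2 *v v) $ 1 = a0 * v $ 1 + x1 * v $ 2"
  "(tridiag3 a0 a1 a2 x1 x2 *v v) $ 2 = v $ 1 + a1 * v $ 2 + x2 * v $ 3"
  "(tridiag3 a0 a1 a2 x1 x2 *v v) $ 3 = v $ 2 + a2 * v $ 3"
  by (simp_all add: tridiag3_def matrix_vector_mult_def sum_3 vector_3)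

lemma diag3_mult [simp]:
  "(diag3 t0 t1 t2 *v v) $ 1 = t0 * v $ 1"
  "(diag3 t0 t1 t2 *v v) $ 2 = t1 * v $ 2"
  "(diag3 t0 t1 t2 *v v) $ 3 = t2 * v $ 3"
  by (simp_all add: diag3_def matrix_vector_mult_def sum_3 vector_3)

lemma vec3_eq_iff: "u = v \<longleftrightarrow> u $ 1 = v $ 1 \<and> u $ 2 = v $ 2 \<and> u $ (3::3) = v $ 3"
  by (simp add: vec_eq_iff forall_3)

text \<open>The determinant of \<open>l\<close> times the identity minus
  \<open>tridiag3 a0 a1 a2 x1 x2\<close>, expanded along the first row. It is also what the first
  coordinate of the eigenvector equation becomes once the other two are solved.\<close>

definition charpoly3 :: "'a::field \<Rightarrow> 'a \<Rightarrow> 'a \<Rightarrow> 'a \<Rightarrow> 'a \<Rightarrow> 'a \<Rightarrow> 'a" where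
  "charpoly3 a0 a1 a2 x1 x2 l = (l - a0) * ((l - a1) * (l - a2) - x2) - x1 * (l - a2)"

text \<open>Every eigenvector of \<open>tridiag3\<close> has a nonzero last coordinate, which is normalised to \<open>1\<close>.\<close>

definition eigvec3 :: "'a::field \<Rightarrow> 'a \<Rightarrow> 'a \<Rightarrow> 'a \<Rightarrow> 'a ^ 3" where
  "eigvec3 a1 a2 x2 l = vector [(l - a1) * (l - a2) - x2, l - a2, 1]"

lemma eigvec3_nth [simp]:
  "eigvec3 a1 a2 x2 l $ 1 = (l - a1) * (l - a2) - x2"
  "eigvec3 a1 a2 x2 l $ 2 = l - a2"
  "eigvec3 a1 a2 x2 l $ 3 = 1"
  by (simp_all add: eigvec3_def vector_3)

lemma tridiag3_eigvec:
  assumes "charpoly3 a0 a1 a2 x1 x2 l = 0"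
  shows "tridiag3 a0 a1 a2 x1 x2 *v eigvec3 a1 a2 x2 l = l *s eigvec3 a1 a2 x2 l"
  using assms by (simp add: vec3_eq_iff charpoly3_def algebra_simps)

text \<open>Because the subdiagonal entries are 1, the third and second coordinate equations
  determine \<open>v $ 2\<close> and \<open>v $ 1\<close> from \<open>v $ 3\<close>; the first then
  reads \<open>v $ 3\<close> times \<open>charpoly3\<close>.\<close>

lemma tridiag3_eigvecD:
  assumes "tridiag3 a0 a1 a2 x1 x2 *v v = l *s v" "v \<noteq> 0"
  shows "v = v $ 3 *s eigvec3 a1 a2 x2 l" "v $ 3 \<noteq> 0" "charpoly3 a0 a1 a2 x1 x2 l = 0"
proof -
  have e: "a0 * v $ 1 + x1 * v $ 2 = l * v $ 1" "v $ 1 + a1 * v $ 2 + x2 * v $ 3 = l * v $ 2"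
    "v $ 2 + a2 * v $ 3 = l * v $ 3"
    using assms(1) by (simp_all add: vec3_eq_iff)
  have v2: "v $ 2 = v $ 3 * (l - a2)"
    using e(3) by (simp add: algebra_simps)
  have v1: "v $ 1 = v $ 3 * ((l - a1) * (l - a2) - x2)"
    using e(2) unfolding v2 by (simp add: algebra_simps)
  show eq: "v = v $ 3 *s eigvec3 a1 a2 x2 l"
    unfolding vec3_eq_iff using v1 v2 by simp
  then show nz: "v $ 3 \<noteq> 0" using assms(2) by auto
  have "v $ 3 * charpoly3 a0 a1 a2 x1 x2 l = l * v $ 1 - a0 * v $ 1 - x1 * v $ 2"
    unfolding v1 v2 charpoly3_def by (simp add: algebra_simps)
  then show "charpoly3 a0 a1 a2 x1 x2 l = 0"
    using e(1) nz by (simp add: algebra_simps)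
qed

text \<open>The weights \<open>1\<close>, \<open>x1\<close>, \<open>x1 * x2\<close> symmetrise
  \<open>tridiag3\<close>: multiplied into its rows, they make entries opposite each other across
  the diagonal equal.\<close>

definition form3 :: "'a::field \<Rightarrow> 'a \<Rightarrow> 'a ^ 3 \<Rightarrow> 'a ^ 3 \<Rightarrow> 'a" where
  "form3 x1 x2 u v = u $ 1 * v $ 1 + x1 * u $ 2 * v $ 2 + x1 * x2 * u $ 3 * v $ 3"

lemma form3_commute: "form3 x1 x2 u v = form3 x1 x2 v u"
  by (simp add: form3_def mult_ac)

lemma form3_linear [simp]:
  "form3 x1 x2 u (v + w) = form3 x1 x2 u v + form3 x1 x2 u w"
  "form3 x1 x2 (v + w) u = form3 x1 x2 v u + form3 x1 x2 w u"
  "form3 x1 x2 u (c *s v) = c * form3 x1 x2 u v"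
  "form3 x1 x2 (c *s v) u = c * form3 x1 x2 v u"
  by (simp_all add: form3_def algebra_simps)

lemma form3_tridiag3:
  "form3 x1 x2 u (tridiag3 a0 a1 a2 x1 x2 *v v) = form3 x1 x2 (tridiag3 a0 a1 a2 x1 x2 *v u) v"
  by (simp add: form3_def algebra_simps)

lemma form3_diag3:
  "form3 x1 x2 u (diag3 t0 t1 t2 *v v) = form3 x1 x2 (diag3 t0 t1 t2 *v u) v"
  by (simp add: form3_def algebra_simps)

lemma form3_eigvec_orthogonal:
  assumes "tridiag3 a0 a1 a2 x1 x2 *v u = l *s u" "tridiag3 a0 a1 a2 x1 x2 *v v = m *s v" "l \<noteq> m"
  shows "form3 x1 x2 u v = 0"
  using form3_tridiag3[of x1 x2 u a0 a1 a2 v] assms by simp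

lemma form3_nondegenerate:
  assumes "x1 \<noteq> 0" "x2 \<noteq> 0" "\<And>v. form3 x1 x2 u v = 0"
  shows "u = 0"
  using assms(3)[of "vector [1, 0, 0]"] assms(3)[of "vector [0, 1, 0]"] assms(3)[of "vector [0, 0, 1]"] assms(1,2)
  by (simp add: form3_def vector_3 vec3_eq_iff)

section \<open>Consequences of being a Leonard pair\<close>

text \<open>The coefficient of \<open>b 2\<close> in \<open>T (T (b 0))\<close> is a product of two
  subdiagonal entries, while \<open>T (b 0)\<close> and \<open>b 0\<close> do not involve
  \<open>b 2\<close>. Hence no monic quadratic annihilates \<open>T\<close>.\<close>

lemma (in vector_space) irreducible_tridiagonal_quadratic:
  assumes "Vector_Spaces.linear scale scale T" "ordered_basis 2 b"
    "irreducible_tridiagonal_matrix 2 (matrix_wrt 2 b T)"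
  shows "T (T (b 0)) + scale p (T (b 0)) + scale q (b 0) \<noteq> 0"
proof
  interpret T: Vector_Spaces.linear scale scale T by fact
  let ?m = "matrix_wrt 2 b T"
  assume *: "T (T (b 0)) + scale p (T (b 0)) + scale q (b 0) = 0"
  have M: "?m 2 0 = 0" "?m 1 0 \<noteq> 0" "?m 2 1 \<noteq> 0"
    using assms(3) unfolding irreducible_tridiagonal_2 by auto
  have 0: "T (b 0) = scale (?m 0 0) (b 0) + scale (?m 1 0) (b 1)"
    using matrix_wrt_2[OF assms(2), of T 0] M by simp
  have 1: "T (T (b 0)) = scale (?m 0 0) (T (b 0)) + scale (?m 1 0) (T (b 1))"
    using arg_cong[OF 0, of T] by (simp only: T.add T.scale)
  have "scale (?m 0 0 * ?m 0 0 + ?m 1 0 * ?m 0 1 + p * ?m 0 0 + q) (b 0)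
      + scale (?m 0 0 * ?m 1 0 + ?m 1 0 * ?m 1 1 + p * ?m 1 0) (b 1)
      + scale (?m 1 0 * ?m 2 1) (b 2) = 0"
    using * unfolding 1 unfolding 0 matrix_wrt_2[OF assms(2), of T 1]
    by (simp add: scale_right_distrib scale_left_distrib algebra_simps)
  from ordered_basis_2_independent(3)[OF assms(2) this] M show False by simp
qed

text \<open>If two diagonal entries agreed, \<open>diag3\<close> would be annihilated by a monic
  quadratic; \<open>p\<close> and \<open>q\<close> are the coefficients of the one whose roots are
  the remaining values.\<close>

lemma leonard_pair_diag3_distinct:
  assumes "vec.leonard_pair 2 T ((*v) (diag3 t0 t1 t2))"
  shows "t0 \<noteq> t1" "t1 \<noteq> t2" "t0 \<noteq> t2"
proof -
  obtain b where b: "vec.ordered_basis 2 b"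
    "irreducible_tridiagonal_matrix 2 (vec.matrix_wrt 2 b ((*v) (diag3 t0 t1 t2)))"
    using assms by (auto simp: vec.leonard_pair_def)
  have *: "diag3 t0 t1 t2 *v (diag3 t0 t1 t2 *v b 0) + p *s (diag3 t0 t1 t2 *v b 0) + q *s b 0 \<noteq> 0"
    for p q
    by (rule vec.irreducible_tridiagonal_quadratic[OF _ b]) simp
  show "t0 \<noteq> t1" using *[of "- (t0 + t2)" "t0 * t2"] by (auto simp: vec3_eq_iff algebra_simps)
  show "t1 \<noteq> t2" using *[of "- (t0 + t2)" "t0 * t2"] by (auto simp: vec3_eq_iff algebra_simps)
  show "t0 \<noteq> t2" using *[of "- (t0 + t1)" "t0 * t1"] by (auto simp: vec3_eq_iff algebra_simps)
qed

text \<open>A basis that diagonalises \<open>diag3\<close> consists of multiples of the coordinate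
  vectors in some order. Irreducibility puts the middle one on the second axis, and then
  \<open>x1\<close> and \<open>x2\<close> are off-diagonal entries up to nonzero factors.\<close>

lemma leonard_pair_tridiag3_offdiag:
  assumes "vec.leonard_pair 2 ((*v) (tridiag3 a0 a1 a2 x1 x2)) ((*v) (diag3 t0 t1 t2))"
  shows "x1 \<noteq> 0" "x2 \<noteq> 0"
proof -
  let ?T = "tridiag3 a0 a1 a2 x1 x2" and ?D = "diag3 t0 t1 t2"
  note t = leonard_pair_diag3_distinct[OF assms]
  obtain b where b: "vec.ordered_basis 2 b"
    "irreducible_tridiagonal_matrix 2 (vec.matrix_wrt 2 b ((*v) ?T))"
    "diagonal_matrix 2 (vec.matrix_wrt 2 b ((*v) ?D))"
    using assms by (auto simp: vec.leonard_pair_def)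
  let ?m = "vec.matrix_wrt 2 b ((*v) ?T)"
  have M: "?m 2 0 = 0" "?m 0 2 = 0" "?m 1 0 \<noteq> 0" "?m 0 1 \<noteq> 0" "?m 1 2 \<noteq> 0" "?m 2 1 \<noteq> 0"
    using b(2) unfolding vec.irreducible_tridiagonal_2 by auto
  have exp: "?T *v b 0 = ?m 0 0 *s b 0 + ?m 1 0 *s b 1"
    "?T *v b 1 = ?m 0 1 *s b 0 + ?m 1 1 *s b 1 + ?m 2 1 *s b 2"
    "?T *v b 2 = ?m 1 2 *s b 1 + ?m 2 2 *s b 2"
    using vec.matrix_wrt_2[OF b(1), of "(*v) ?T"] M by auto
  note ind = vec.ordered_basis_2_independent[OF b(1)]
  have nz: "b 0 \<noteq> 0" "b 1 \<noteq> 0" "b 2 \<noteq> 0"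
    using ind(1)[of 1 0 0] ind(2)[of 0 1 0] ind(3)[of 0 0 1] by auto
  have axis: "(v $ 2 = 0 \<and> v $ 3 = 0) \<or> (v $ 1 = 0 \<and> v $ 3 = 0) \<or> (v $ 1 = 0 \<and> v $ 2 = 0)"
    if "?D *v v = l *s v" for v l
    using that t by (auto simp: vec3_eq_iff)
  have ax: "(b j $ 2 = 0 \<and> b j $ 3 = 0) \<or> (b j $ 1 = 0 \<and> b j $ 3 = 0) \<or> (b j $ 1 = 0 \<and> b j $ 2 = 0)"
    if "j \<le> 2" for j
    using axis[OF vec.diagonal_matrix_wrt_eigenvector[OF b(1,3) that]] .
  \<comment> \<open>Two basis vectors sharing a nonzero coordinate would lie on one axis, and
    cross-multiplication by that coordinate would give a nontrivial dependency.\<close>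
  have nc: "b 0 $ i * b 1 $ i = 0" "b 1 $ i * b 2 $ i = 0" "b 0 $ i * b 2 $ i = 0" for i
  proof -
    have i: "i = 1 \<or> i = 2 \<or> i = 3" using exhaust_3 by auto
    have "(b 1 $ i) *s b 0 + (- b 0 $ i) *s b 1 + 0 *s b 2 = 0" if "b 0 $ i * b 1 $ i \<noteq> 0"
      using that ax[of 0] ax[of 1] i by (auto simp: vec3_eq_iff)
    from ind(1)[OF this] show "b 0 $ i * b 1 $ i = 0" by auto
    have "0 *s b 0 + (b 2 $ i) *s b 1 + (- b 1 $ i) *s b 2 = 0" if "b 1 $ i * b 2 $ i \<noteq> 0"
      using that ax[of 1] ax[of 2] i by (auto simp: vec3_eq_iff)
    from ind(2)[OF this] show "b 1 $ i * b 2 $ i = 0" by auto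
    have "(b 2 $ i) *s b 0 + 0 *s b 1 + (- b 0 $ i) *s b 2 = 0" if "b 0 $ i * b 2 $ i \<noteq> 0"
      using that ax[of 0] ax[of 2] i by (auto simp: vec3_eq_iff)
    from ind(1)[OF this] show "b 0 $ i * b 2 $ i = 0" by auto
  qed
  have E: "a0 * b 0 $ 1 + x1 * b 0 $ 2 = ?m 0 0 * b 0 $ 1 + ?m 1 0 * b 1 $ 1"
    "b 0 $ 1 + a1 * b 0 $ 2 + x2 * b 0 $ 3 = ?m 0 0 * b 0 $ 2 + ?m 1 0 * b 1 $ 2"
    "b 0 $ 2 + a2 * b 0 $ 3 = ?m 0 0 * b 0 $ 3 + ?m 1 0 * b 1 $ 3"
    "a0 * b 1 $ 1 + x1 * b 1 $ 2 = ?m 0 1 * b 0 $ 1 + ?m 1 1 * b 1 $ 1 + ?m 2 1 * b 2 $ 1"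
    "b 1 $ 1 + a1 * b 1 $ 2 + x2 * b 1 $ 3 = ?m 0 1 * b 0 $ 2 + ?m 1 1 * b 1 $ 2 + ?m 2 1 * b 2 $ 2"
    "b 1 $ 2 + a2 * b 1 $ 3 = ?m 0 1 * b 0 $ 3 + ?m 1 1 * b 1 $ 3 + ?m 2 1 * b 2 $ 3"
    "a0 * b 2 $ 1 + x1 * b 2 $ 2 = ?m 1 2 * b 1 $ 1 + ?m 2 2 * b 2 $ 1"
    "b 2 $ 1 + a1 * b 2 $ 2 + x2 * b 2 $ 3 = ?m 1 2 * b 1 $ 2 + ?m 2 2 * b 2 $ 2"
    "b 2 $ 2 + a2 * b 2 $ 3 = ?m 1 2 * b 1 $ 3 + ?m 2 2 * b 2 $ 3"
    using exp by (simp_all add: vec3_eq_iff)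
  have nz': "b j $ 1 \<noteq> 0 \<or> b j $ 2 \<noteq> 0 \<or> b j $ 3 \<noteq> 0" if "j = 0 \<or> j = 1 \<or> j = 2" for j
    using nz that by (auto simp: vec3_eq_iff)
  note nz' = nz'[of 0, simplified] nz'[of 1, simplified] nz'[of 2, simplified]
  \<comment> \<open>The image of \<open>b 1\<close> involves both \<open>b 0\<close> and
    \<open>b 2\<close>. On the first axis its image would have no third coordinate, on the third
    axis no first one, so neither axis is possible.\<close>
  have b1: "b 1 $ 1 = 0" "b 1 $ 3 = 0"
    using ax[of 0] ax[of 1] ax[of 2] nz' nc[of 1] nc[of 2] nc[of 3] E(3,4,6,7) M
    by auto
  then have b02: "b 1 $ 2 \<noteq> 0" "b 0 $ 2 = 0" "b 2 $ 2 = 0"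
    using nz' nc[of 2] by auto
  have "x1 \<noteq> 0 \<and> x2 \<noteq> 0"
    using ax[of 0] ax[of 2] nz' nc[of 1] nc[of 3] b1 b02 E(2,4,8) M
    by auto
  then show "x1 \<noteq> 0" "x2 \<noteq> 0" by simp_all
qed

text \<open>Eigenvectors for one eigenvalue are all multiples of the same \<open>eigvec3\<close>, so
  the basis vectors have distinct eigenvalues and are pairwise orthogonal. Tridiagonality leaves no
  \<open>b 0\<close> component in the image of \<open>b 2\<close> under \<open>diag3\<close>, hence
  the form vanishes.\<close>

lemma leonard_pair_imp_roots:
  assumes "vec.leonard_pair 2 ((*v) (tridiag3 a0 a1 a2 x1 x2)) ((*v) (diag3 t0 t1 t2))"
  obtains l0 l1 l2 where "l0 \<noteq> l1" "l1 \<noteq> l2" "l0 \<noteq> l2"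
    "charpoly3 a0 a1 a2 x1 x2 l0 = 0" "charpoly3 a0 a1 a2 x1 x2 l1 = 0" "charpoly3 a0 a1 a2 x1 x2 l2 = 0"
    "form3 x1 x2 (eigvec3 a1 a2 x2 l0) (diag3 t0 t1 t2 *v eigvec3 a1 a2 x2 l2) = 0"
proof -
  let ?T = "tridiag3 a0 a1 a2 x1 x2" and ?D = "diag3 t0 t1 t2" and ?v = "eigvec3 a1 a2 x2"
  obtain b where b: "vec.ordered_basis 2 b"
    "irreducible_tridiagonal_matrix 2 (vec.matrix_wrt 2 b ((*v) ?D))"
    "diagonal_matrix 2 (vec.matrix_wrt 2 b ((*v) ?T))"
    using assms by (auto simp: vec.leonard_pair_def)
  define l where "l j = vec.matrix_wrt 2 b ((*v) ?T) j j" for j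
  have eig: "?T *v b j = l j *s b j" if "j \<le> 2" for j
    using vec.diagonal_matrix_wrt_eigenvector[OF b(1,3) that] by (simp add: l_def)
  note ind = vec.ordered_basis_2_independent[OF b(1)]
  have nz: "b j \<noteq> 0" if "j \<le> 2" for j
  proof -
    have "j = 0 \<or> j = 1 \<or> j = 2" using that by auto
    then show ?thesis
      using ind(1)[of 1 0 0] ind(2)[of 0 1 0] ind(3)[of 0 0 1] by auto
  qed
  have bv: "b j = b j $ 3 *s ?v (l j)" and b3: "b j $ 3 \<noteq> 0" and ch: "charpoly3 a0 a1 a2 x1 x2 (l j) = 0"
    if "j \<le> 2" for j
    using tridiag3_eigvecD[OF eig nz] that by auto
  have dep: "b j $ 3 *s b i - b i $ 3 *s b j = 0" if "l i = l j" "i \<le> 2" "j \<le> 2" for i j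
  proof -
    have "b j $ 3 * b i $ k = b i $ 3 * b j $ k" for k
      using arg_cong[OF bv[OF that(2)], of "\<lambda>v. v $ k"] arg_cong[OF bv[OF that(3)], of "\<lambda>v. v $ k"]
      by (metis that(1) mult.left_commute vector_smult_component)
    then show ?thesis by (simp add: vec_eq_iff)
  qed
  have ne: "l 0 \<noteq> l 1" "l 1 \<noteq> l 2" "l 0 \<noteq> l 2"
    using dep[of 0 1] ind(1)[of "b 1 $ 3" "- b 0 $ 3" 0] dep[of 1 2] ind(2)[of 0 "b 2 $ 3" "- b 1 $ 3"]
      dep[of 0 2] ind(1)[of "b 2 $ 3" 0 "- b 0 $ 3"] b3[of 1] b3[of 2]
    by auto
  have orth: "form3 x1 x2 (b i) (b j) = 0" if "l i \<noteq> l j" "i \<le> 2" "j \<le> 2" for i j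
    using form3_eigvec_orthogonal eig that by blast
  let ?m = "vec.matrix_wrt 2 b ((*v) ?D)"
  have D2: "?D *v b 2 = ?m 1 2 *s b 1 + ?m 2 2 *s b 2"
    using vec.matrix_wrt_2[OF b(1), of "(*v) ?D" 2] b(2)
    unfolding vec.irreducible_tridiagonal_2 by simp
  have "form3 x1 x2 (b 0) (?D *v b 2) = 0"
    unfolding D2 using orth[of 0 1] orth[of 0 2] ne by simp
  then have "form3 x1 x2 (b 0 $ 3 *s ?v (l 0)) (?D *v (b 2 $ 3 *s ?v (l 2))) = 0"
    using bv[of 0] bv[of 2] by simp
  then have "form3 x1 x2 (?v (l 0)) (?D *v ?v (l 2)) = 0"
    using b3[of 0] b3[of 2] by (simp add: vec.scale)
  then show ?thesis
    using that[OF ne] ch by simp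
qed

section \<open>From three roots to a Leonard pair\<close>

text \<open>A Vandermonde argument: the coordinates of \<open>eigvec3\<close> are monic polynomials
  in \<open>l\<close> of degrees 2, 1, 0, so a dependency also holds for the values of
  \<open>(l - m) * (l - n)\<close>. Taking two of the points for \<open>m\<close> and
  \<open>n\<close> isolates one coefficient.\<close>

lemma ordered_basis_eigvec3:
  assumes "l0 \<noteq> l1" "l1 \<noteq> l2" "l0 \<noteq> l2"
  shows "vec.ordered_basis 2 (basis3 (eigvec3 a1 a2 x2 l0) (eigvec3 a1 a2 x2 l1) (eigvec3 a1 a2 x2 l2))"
proof (rule ordered_basis_basis3)
  fix p q r
  let ?f = "\<lambda>l. (l - a1) * (l - a2) - x2"
  assume "p *s eigvec3 a1 a2 x2 l0 + q *s eigvec3 a1 a2 x2 l1 + r *s eigvec3 a1 a2 x2 l2 = 0"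
  then have e: "p * ?f l0 + q * ?f l1 + r * ?f l2 = 0"
    "p * (l0 - a2) + q * (l1 - a2) + r * (l2 - a2) = 0" "p + q + r = 0"
    by (simp_all add: vec3_eq_iff)
  have quad: "p * ((l0 - m) * (l0 - n)) + q * ((l1 - m) * (l1 - n)) + r * ((l2 - m) * (l2 - n)) = 0" for m n
  proof -
    have "p * ((l0 - m) * (l0 - n)) + q * ((l1 - m) * (l1 - n)) + r * ((l2 - m) * (l2 - n)) =
      (p * ?f l0 + q * ?f l1 + r * ?f l2)
      + (a1 + a2 - m - n) * (p * (l0 - a2) + q * (l1 - a2) + r * (l2 - a2))
      + ((a1 + a2 - m - n) * a2 + m * n - a1 * a2 + x2) * (p + q + r)"
      by (simp add: algebra_simps)
    then show ?thesis unfolding e by simp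
  qed
  show "p = 0 \<and> q = 0 \<and> r = 0"
    using quad[of l1 l2] quad[of l0 l2] quad[of l0 l1] assms by simp
qed

text \<open>As \<open>t2\<close> differs from the other entries, \<open>v\<close> lies on the third
  axis. The second coordinate of its image under \<open>tridiag3\<close> is then
  \<open>x2 * v $ 3\<close>, which has to vanish.\<close>

lemma diag3_tridiag3_no_common_eigenvector:
  assumes "diag3 t0 t1 t2 *v v = c *s v" "tridiag3 a0 a1 a2 x1 x2 *v v = l *s v" "v $ 3 \<noteq> 0"
    "t1 \<noteq> t2" "t0 \<noteq> t2"
  shows "x2 = 0"
  using assms by (auto simp: vec3_eq_iff)

text \<open>The standard basis gives one half, the eigenvectors the other. The latter are
  orthogonal, so pairing with them reads off the matrix entries of \<open>diag3\<close>, and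
  opposite entries vanish together.\<close>

lemma roots_imp_leonard_pair:
  assumes x: "x1 \<noteq> 0" "x2 \<noteq> 0" and t: "t1 \<noteq> t2" "t0 \<noteq> t2"
    and ne: "l0 \<noteq> l1" "l1 \<noteq> l2" "l0 \<noteq> l2"
    and ch: "charpoly3 a0 a1 a2 x1 x2 l0 = 0" "charpoly3 a0 a1 a2 x1 x2 l1 = 0" "charpoly3 a0 a1 a2 x1 x2 l2 = 0"
    and form: "form3 x1 x2 (eigvec3 a1 a2 x2 l0) (diag3 t0 t1 t2 *v eigvec3 a1 a2 x2 l2) = 0"
  shows "vec.leonard_pair 2 ((*v) (tridiag3 a0 a1 a2 x1 x2)) ((*v) (diag3 t0 t1 t2))"
proof -
  let ?T = "tridiag3 a0 a1 a2 x1 x2" and ?D = "diag3 t0 t1 t2" and ?v = "eigvec3 a1 a2 x2"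
  let ?e = "basis3 (vector [1, 0, 0]) (vector [0, 1, 0]) (vector [0, 0, 1]) :: nat \<Rightarrow> 'a ^ 3"
  have e: "vec.ordered_basis 2 ?e"
    by (rule ordered_basis_basis3) (simp add: vec3_eq_iff vector_3)
  have "irreducible_tridiagonal_matrix 2 (vec.matrix_wrt 2 ?e ((*v) ?T))"
    using vec.matrix_wrt_2[OF e, of "(*v) ?T" 0] vec.matrix_wrt_2[OF e, of "(*v) ?T" 1]
      vec.matrix_wrt_2[OF e, of "(*v) ?T" 2] x
    by (simp add: vec.irreducible_tridiagonal_2 vec3_eq_iff vector_3)
  moreover have "?D *v ?e j = basis3 t0 t1 t2 j *s ?e j" for j
    by (simp add: basis3_def vec3_eq_iff vector_3)
  then have "diagonal_matrix 2 (vec.matrix_wrt 2 ?e ((*v) ?D))"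
    by (intro vec.diagonal_matrix_wrtI[OF e])
  moreover
  let ?b = "basis3 (?v l0) (?v l1) (?v l2)"
  let ?m = "vec.matrix_wrt 2 ?b ((*v) ?D)"
  note b = ordered_basis_eigvec3[OF ne, of a1 a2 x2]
  have eig: "?T *v ?v l0 = l0 *s ?v l0" "?T *v ?v l1 = l1 *s ?v l1" "?T *v ?v l2 = l2 *s ?v l2"
    using ch by (simp_all add: tridiag3_eigvec)
  have "?T *v ?b j = basis3 l0 l1 l2 j *s ?b j" for j
    using eig by (simp add: basis3_def)
  then have "diagonal_matrix 2 (vec.matrix_wrt 2 ?b ((*v) ?T))"
    by (intro vec.diagonal_matrix_wrtI[OF b])
  moreover have "irreducible_tridiagonal_matrix 2 ?m"
  proof -
    have orth: "form3 x1 x2 (?v l0) (?v l1) = 0" "form3 x1 x2 (?v l1) (?v l2) = 0" "form3 x1 x2 (?v l0) (?v l2) = 0"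
      using form3_eigvec_orthogonal eig ne by blast+
    then have orth': "form3 x1 x2 (?v l1) (?v l0) = 0" "form3 x1 x2 (?v l2) (?v l1) = 0" "form3 x1 x2 (?v l2) (?v l0) = 0"
      by (simp_all add: form3_commute)
    have span: "\<exists>p q r. w = p *s ?v l0 + q *s ?v l1 + r *s ?v l2" for w
      using vec.matrix_wrt_2[OF b, of "\<lambda>_. w" 0] by simp blast
    have nz: "?v l \<noteq> 0" for l by (simp add: vec3_eq_iff)
    \<comment> \<open>A vector \<open>?v l\<close> of length zero would be orthogonal to all three
      eigenvectors, which span, against nondegeneracy.\<close>
    have iso: "form3 x1 x2 (?v l) (?v l) \<noteq> 0" if l: "l = l0 \<or> l = l1 \<or> l = l2" for l
    proof
      assume 0: "form3 x1 x2 (?v l) (?v l) = 0"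
      have "form3 x1 x2 (?v l) w = 0" for w
        using span[of w] l orth orth' 0 by auto
      from form3_nondegenerate[OF x this] nz show False by blast
    qed
    have D: "?D *v ?v l0 = ?m 0 0 *s ?v l0 + ?m 1 0 *s ?v l1 + ?m 2 0 *s ?v l2"
      "?D *v ?v l1 = ?m 0 1 *s ?v l0 + ?m 1 1 *s ?v l1 + ?m 2 1 *s ?v l2"
      "?D *v ?v l2 = ?m 0 2 *s ?v l0 + ?m 1 2 *s ?v l1 + ?m 2 2 *s ?v l2"
      using vec.matrix_wrt_2[OF b, of "(*v) ?D" 0] vec.matrix_wrt_2[OF b, of "(*v) ?D" 1]
        vec.matrix_wrt_2[OF b, of "(*v) ?D" 2] by simp_all
    have ent: "form3 x1 x2 (?v l0) (?D *v ?v l1) = ?m 0 1 * form3 x1 x2 (?v l0) (?v l0)"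
      "form3 x1 x2 (?v l0) (?D *v ?v l2) = ?m 0 2 * form3 x1 x2 (?v l0) (?v l0)"
      "form3 x1 x2 (?v l1) (?D *v ?v l0) = ?m 1 0 * form3 x1 x2 (?v l1) (?v l1)"
      "form3 x1 x2 (?v l1) (?D *v ?v l2) = ?m 1 2 * form3 x1 x2 (?v l1) (?v l1)"
      "form3 x1 x2 (?v l2) (?D *v ?v l0) = ?m 2 0 * form3 x1 x2 (?v l2) (?v l2)"
      "form3 x1 x2 (?v l2) (?D *v ?v l1) = ?m 2 1 * form3 x1 x2 (?v l2) (?v l2)"
      unfolding D by (simp_all add: orth orth')
    have sym: "form3 x1 x2 (?v l) (?D *v ?v l') = form3 x1 x2 (?v l') (?D *v ?v l)" for l l'
      using form3_diag3 form3_commute by metis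
    have m02: "?m 0 2 = 0" "?m 2 0 = 0"
      using ent(2,5) form sym[of l2 l0] iso by simp_all
    \<comment> \<open>If one of these entries vanished as well, \<open>?v l0\<close> or
      \<open>?v l2\<close> would be an eigenvector of both matrices.\<close>
    have m: "?m 1 0 \<noteq> 0" "?m 1 2 \<noteq> 0"
      using diag3_tridiag3_no_common_eigenvector[OF _ eig(1) _ t, of "?m 0 0"]
        diag3_tridiag3_no_common_eigenvector[OF _ eig(3) _ t, of "?m 2 2"] D(1,3) m02 x(2) by auto
    then have "?m 0 1 \<noteq> 0" "?m 2 1 \<noteq> 0"
      using ent(1,3,4,6) sym[of l0 l1] sym[of l2 l1] iso by auto
    with m m02 show ?thesis
      unfolding vec.irreducible_tridiagonal_2 by simp
  qed
  ultimately show ?thesis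
    unfolding vec.leonard_pair_def using e b by auto
qed

section \<open>Primitive idempotents and the flat part\<close>

text \<open>The definite description is unique because every vector splits into coordinate parts
  lying in eigenspaces, where a linear \<open>E\<close> is prescribed.\<close>

lemma primitive_idempotent_diag3:
  fixes t0 t1 t2 :: "'a::field"
  assumes "t0 \<noteq> t1" "t1 \<noteq> t2" "t0 \<noteq> t2"
  shows "vec.primitive_idempotent ((*v) (diag3 t0 t1 t2)) t0 = (*v) (diag3 1 0 0)" (is ?P)
    "vec.primitive_idempotent ((*v) (diag3 t0 t1 t2)) t1 = (*v) (diag3 0 1 0)" (is ?Q)
    "vec.primitive_idempotent ((*v) (diag3 t0 t1 t2)) t2 = (*v) (diag3 0 0 1)" (is ?R)
proof -
  have eig: "v \<in> vec.eigenspace ((*v) (diag3 t0 t1 t2)) \<mu> \<longleftrightarrow>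
      (v $ 1 = 0 \<or> \<mu> = t0) \<and> (v $ 2 = 0 \<or> \<mu> = t1) \<and> (v $ 3 = 0 \<or> \<mu> = t2)" for v \<mu>
    by (auto simp: vec.eigenspace_def vec3_eq_iff)
  have main: "vec.primitive_idempotent ((*v) (diag3 t0 t1 t2)) \<theta> = (*v) P"
    if P: "P = diag3 (if \<theta> = t0 then 1 else 0) (if \<theta> = t1 then 1 else 0) (if \<theta> = t2 then 1 else 0)"
    for \<theta> P
    unfolding vec.primitive_idempotent_def
  proof (rule the_equality, intro conjI ballI allI impI)
    show "P *v v = v" if "v \<in> vec.eigenspace ((*v) (diag3 t0 t1 t2)) \<theta>" for v
      using that assms unfolding eig P by (auto simp: vec3_eq_iff)
    show "P *v v = 0" if "\<mu> \<noteq> \<theta>" "v \<in> vec.eigenspace ((*v) (diag3 t0 t1 t2)) \<mu>" for v \<mu>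
      using that assms unfolding eig P by (auto simp: vec3_eq_iff)
  next
    fix E
    assume E: "Vector_Spaces.linear (*s) (*s) E \<and>
        (\<forall>v\<in>vec.eigenspace ((*v) (diag3 t0 t1 t2)) \<theta>. E v = v) \<and>
        (\<forall>\<mu>. \<mu> \<noteq> \<theta> \<longrightarrow> (\<forall>v\<in>vec.eigenspace ((*v) (diag3 t0 t1 t2)) \<mu>. E v = 0))"
    then interpret E: Vector_Spaces.linear "(*s)" "(*s)" E by blast
    have Ev: "E v = (if \<mu> = \<theta> then v else 0)"
      if "v \<in> vec.eigenspace ((*v) (diag3 t0 t1 t2)) \<mu>" for v \<mu>
      using E that by auto
    show "E = (*v) P"
    proof
      fix v :: "'a ^ 3"
      have "v = vector [v $ 1, 0, 0] + vector [0, v $ 2, 0] + vector [0, 0, v $ 3]"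
        by (simp add: vec3_eq_iff vector_3)
      then have "E v = E (vector [v $ 1, 0, 0]) + E (vector [0, v $ 2, 0]) + E (vector [0, 0, v $ 3])"
        by (metis E.add)
      also have "\<dots> = P *v v"
        using Ev[of "vector [v $ 1, 0, 0]" t0] Ev[of "vector [0, v $ 2, 0]" t1]
          Ev[of "vector [0, 0, v $ 3]" t2]
        by (auto simp: eig vector_3 P vec3_eq_iff)
      finally show "E v = P *v v" .
    qed
  qed simp
  show ?P ?Q ?R
    using assms by (auto intro!: main)
qed

lemma flat_part_tridiag3:
  assumes "t0 \<noteq> t1" "t1 \<noteq> t2" "t0 \<noteq> t2"
  shows "vec.flat_part ((*v) (tridiag3 a0 a1 a2 x1 x2)) ((*v) (diag3 t0 t1 t2)) v = diag3 a0 a1 a2 *v v"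
proof -
  have "vec.eigenvalues ((*v) (diag3 t0 t1 t2)) = {t0, t1, t2}"
  proof (intro equalityI subsetI)
    fix \<theta> assume "\<theta> \<in> vec.eigenvalues ((*v) (diag3 t0 t1 t2))"
    then show "\<theta> \<in> {t0, t1, t2}"
      by (auto simp: vec.eigenvalues_def vec.eigenspace_def vec3_eq_iff)
  next
    fix \<theta> assume "\<theta> \<in> {t0, t1, t2}"
    then show "\<theta> \<in> vec.eigenvalues ((*v) (diag3 t0 t1 t2))"
      unfolding vec.eigenvalues_def vec.eigenspace_def mem_Collect_eq
      by (intro exI[of _ "vector [if \<theta> = t0 then 1 else 0, if \<theta> = t1 then 1 else 0, if \<theta> = t2 then 1 else 0]"])
        (auto simp: vec3_eq_iff vector_3)
  qed
  then show ?thesis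
    using assms by (simp add: vec.flat_part_def primitive_idempotent_diag3 vec3_eq_iff)
qed

section \<open>The orthogonality condition and the bipartite pair\<close>

text \<open>Subtracting \<open>t0 * form3 x1 x2 ?u ?v\<close>, which is zero, removes the first
  coordinates; \<open>rel\<close> then makes \<open>x1 * (t0 - t1)\<close> a common factor of what
  is left.\<close>

lemma form3_eigvec3_diag3_eq_0_iff:
  assumes "x1 \<noteq> 0" "t0 \<noteq> t1" and rel: "x1 * (t0 - t1) = x2 * (t1 - t2)"
    and "l \<noteq> m" "charpoly3 a0 a1 a2 x1 x2 l = 0" "charpoly3 a0 a1 a2 x1 x2 m = 0"
  shows "form3 x1 x2 (eigvec3 a1 a2 x2 l) (diag3 t0 t1 t2 *v eigvec3 a1 a2 x2 m) = 0 \<longleftrightarrow>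
    (l - a2) * (m - a2) = - (x1 + x2)"
proof -
  let ?u = "eigvec3 a1 a2 x2 l" and ?v = "eigvec3 a1 a2 x2 m"
  have orth: "form3 x1 x2 ?u ?v = 0"
    using form3_eigvec_orthogonal tridiag3_eigvec assms by blast
  have "form3 x1 x2 ?u (diag3 t0 t1 t2 *v ?v) =
      t0 * form3 x1 x2 ?u ?v - x1 * (t0 - t1) * ((l - a2) * (m - a2)) - x1 * (x2 * (t0 - t1) + x2 * (t1 - t2))"
    by (simp add: form3_def algebra_simps)
  also have "\<dots> = - (x1 * (t0 - t1)) * ((l - a2) * (m - a2) + (x1 + x2))"
    unfolding orth rel[symmetric] by (simp add: algebra_simps)
  finally show ?thesis
    using assms(1,2) by (simp add: add_eq_0_iff2)
qed

text \<open>The cubic is \<open>l * (l * l - (x1 + x2))\<close>, so \<open>x1 + x2 = 0\<close> would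
  leave only the root 0. If \<open>l0\<close> or \<open>l2\<close> were 0, the form would equal
  \<open>x1 * x2 * (t2 - t0)\<close>, which is nonzero. So they are opposite square roots of
  \<open>x1 + x2\<close>, and the vanishing form yields the relation.\<close>

lemma bipartite_leonard_pair_relation:
  assumes "vec.leonard_pair 2 ((*v) (tridiag3 0 0 0 x1 x2)) ((*v) (diag3 t0 t1 t2))"
  shows "x1 + x2 \<noteq> 0" "x1 * (t0 - t1) = x2 * (t1 - t2)"
proof -
  note t = leonard_pair_diag3_distinct[OF assms] and x = leonard_pair_tridiag3_offdiag[OF assms]
  obtain l0 l1 l2 where ne: "l0 \<noteq> l1" "l1 \<noteq> l2" "l0 \<noteq> l2"
    and ch: "charpoly3 0 0 0 x1 x2 l0 = 0" "charpoly3 0 0 0 x1 x2 l1 = 0" "charpoly3 0 0 0 x1 x2 l2 = 0"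
    and form: "form3 x1 x2 (eigvec3 0 0 x2 l0) (diag3 t0 t1 t2 *v eigvec3 0 0 x2 l2) = 0"
    using leonard_pair_imp_roots[OF assms] by blast
  have root: "l = 0 \<or> l * l = x1 + x2" if "charpoly3 0 0 0 x1 x2 l = 0" for l
  proof -
    have "charpoly3 0 0 0 x1 x2 l = l * (l * l - (x1 + x2))"
      by (simp add: charpoly3_def algebra_simps)
    with that show ?thesis by simp
  qed
  show S: "x1 + x2 \<noteq> 0"
    using root[OF ch(1)] root[OF ch(2)] ne by auto
  have "l0 \<noteq> 0"
  proof
    assume "l0 = 0"
    then have "l2 * l2 - x2 = x1" using root[OF ch(3)] ne by auto
    then have "x1 * x2 * (t2 - t0) = 0"
      using form \<open>l0 = 0\<close> by (simp add: form3_def algebra_simps)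
    then show False using x t by simp
  qed
  moreover have "l2 \<noteq> 0"
  proof
    assume "l2 = 0"
    then have "l0 * l0 - x2 = x1" using root[OF ch(1)] ne by auto
    then have "x1 * x2 * (t2 - t0) = 0"
      using form \<open>l2 = 0\<close> by (simp add: form3_def algebra_simps)
    then show False using x t by simp
  qed
  ultimately have sq: "l0 * l0 = x1 + x2" "l2 * l2 = x1 + x2"
    using root ch by blast+
  then have "(l0 - l2) * (l0 + l2) = 0"
    by (simp add: algebra_simps)
  then have "l2 = - l0"
    using ne(3) by (simp add: eq_neg_iff_add_eq_0 add.commute)
  then have v: "l0 * l0 - x2 = x1" "l2 * l2 - x2 = x1" "l0 * l2 = - (x1 + x2)"
    using sq by simp_all
  have "form3 x1 x2 (eigvec3 0 0 x2 l0) (diag3 t0 t1 t2 *v eigvec3 0 0 x2 l2) =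
      (l0 * l0 - x2) * (l2 * l2 - x2) * t0 + x1 * t1 * (l0 * l2) + x1 * x2 * t2"
    by (simp add: form3_def algebra_simps)
  also have "\<dots> = x1 * (x1 * (t0 - t1) - x2 * (t1 - t2))"
    unfolding v by (simp add: algebra_simps)
  finally have "x1 * (x1 * (t0 - t1) - x2 * (t1 - t2)) = 0"
    using form by simp
  then show "x1 * (t0 - t1) = x2 * (t1 - t2)"
    using x(1) by simp
qed

section \<open>Roots of cubics and quadratics\<close>

lemma charpoly3_factor:
  assumes ne: "l0 \<noteq> l1" "l1 \<noteq> l2" "l0 \<noteq> l2"
    and ch: "charpoly3 a0 a1 a2 x1 x2 l0 = 0" "charpoly3 a0 a1 a2 x1 x2 l1 = 0" "charpoly3 a0 a1 a2 x1 x2 l2 = 0"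
  shows "l0 + l1 + l2 = a0 + a1 + a2"
    "charpoly3 a0 a1 a2 x1 x2 l = (l - l0) * (l - l1) * (l - l2)"
proof -
  define c1 where "c1 = a0 * a1 + a0 * a2 + a1 * a2 - x1 - x2"
  \<comment> \<open>The divided difference of the cubic; it vanishes at two distinct roots.
    Differencing it once more gives the sum of the roots and the factorisation.\<close>
  define q where "q l m = l * l + l * m + m * m - (a0 + a1 + a2) * (l + m) + c1" for l m
  have diff: "charpoly3 a0 a1 a2 x1 x2 l - charpoly3 a0 a1 a2 x1 x2 m = (l - m) * q l m" for l m
    by (simp add: charpoly3_def q_def c1_def algebra_simps)
  have q: "q l0 l1 = 0" "q l1 l2 = 0"
    using diff[of l0 l1] diff[of l1 l2] ch ne by auto
  have "(l0 - l2) * (l0 + l1 + l2 - (a0 + a1 + a2)) = q l0 l1 - q l1 l2"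
    by (simp add: q_def algebra_simps)
  then show s: "l0 + l1 + l2 = a0 + a1 + a2"
    using q ne by simp
  have "charpoly3 a0 a1 a2 x1 x2 l = (l - l0) * q l l0"
    using diff[of l l0] ch by simp
  also have "q l l0 = q l l0 - q l0 l1"
    using q by simp
  also have "\<dots> = (l - l1) * (l + l0 + l1 - (a0 + a1 + a2))"
    by (simp add: q_def algebra_simps)
  also have "l + l0 + l1 - (a0 + a1 + a2) = l - l2"
    unfolding s[symmetric] by simp
  finally show "charpoly3 a0 a1 a2 x1 x2 l = (l - l0) * (l - l1) * (l - l2)"
    by (simp add: mult.assoc)
qed

lemma quadratic_distinct_roots:
  fixes s q :: "'a::alg_closed_field"
  assumes "CHAR('a) \<noteq> 2" "s\<^sup>2 - 4 * q \<noteq> 0"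
  obtains l m where "l \<noteq> m" "l + m = s" "l * m = q"
proof -
  \<comment> \<open>A divisor of 2 is 1 or 2, and no field has characteristic 1.\<close>
  have "\<not> CHAR('a) dvd 2"
    using assms(1) two_is_prime_nat by (auto simp: prime_nat_iff)
  then have two: "(2::'a) \<noteq> 0"
    using of_nat_eq_0_iff_char_dvd[of 2, where 'a = 'a] by simp
  obtain r where r: "r ^ 2 = s\<^sup>2 - 4 * q"
    using nth_root_exists[of 2 "s\<^sup>2 - 4 * q"] by auto
  have "r \<noteq> 0" using r assms(2) by auto
  have "(2::'a) * 2 \<noteq> 0" using two by (metis mult_eq_0_iff)
  then have four: "(4::'a) \<noteq> 0" by simp
  have "(s + r) / 2 - (s - r) / 2 = r"
    using two four by (simp add: field_simps)
  then have "(s + r) / 2 \<noteq> (s - r) / 2"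
    using \<open>r \<noteq> 0\<close> by (metis diff_self)
  moreover have "(s + r) / 2 + (s - r) / 2 = s"
    using two four by (simp add: field_simps)
  moreover have "(s + r) / 2 * ((s - r) / 2) = (s\<^sup>2 - r ^ 2) / 4"
    by (simp add: power2_eq_square algebra_simps)
  then have "(s + r) / 2 * ((s - r) / 2) = q"
    unfolding r using four by simp
  ultimately show ?thesis using that by blast
qed

section \<open>From expansions to roots to coefficients\<close>

text \<open>The flat part is the diagonal, so the contraction is the given bipartite pair for all
  \<open>a0\<close>, \<open>a1\<close>, \<open>a2\<close>; only the Leonard property of the expanded
  pair remains.\<close>

lemma near_bipartite_expansion_tridiag3_iff:
  assumes "vec.leonard_pair 2 ((*v) (tridiag3 0 0 0 x1 x2)) ((*v) (diag3 t0 t1 t2))"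
  shows "vec.near_bipartite_expansion 2 ((*v) (tridiag3 a0 a1 a2 x1 x2)) ((*v) (tridiag3 0 0 0 x1 x2))
      ((*v) (diag3 t0 t1 t2)) \<longleftrightarrow>
    vec.leonard_pair 2 ((*v) (tridiag3 a0 a1 a2 x1 x2)) ((*v) (diag3 t0 t1 t2))"
proof -
  note flat = flat_part_tridiag3[OF leonard_pair_diag3_distinct[OF assms]]
  have "vec.bipartite_contraction ((*v) (tridiag3 a0 a1 a2 x1 x2)) ((*v) (diag3 t0 t1 t2)) =
      (*v) (tridiag3 0 0 0 x1 x2)"
    by (rule ext) (simp add: vec.bipartite_contraction_def flat vec3_eq_iff)
  moreover have "vec.flat_part ((*v) (tridiag3 0 0 0 x1 x2)) ((*v) (diag3 t0 t1 t2)) = (\<lambda>v. 0)"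
    by (rule ext) (simp add: flat vec3_eq_iff)
  ultimately show ?thesis
    using assms
    by (simp add: vec.near_bipartite_expansion_def vec.bipartite_leonard_pair_def
        vec.near_bipartite_leonard_pair_def)
qed

lemma leonard_pair_tridiag3_iff_roots:
  assumes "vec.leonard_pair 2 ((*v) (tridiag3 0 0 0 x1 x2)) ((*v) (diag3 t0 t1 t2))"
  shows "vec.leonard_pair 2 ((*v) (tridiag3 a0 a1 a2 x1 x2)) ((*v) (diag3 t0 t1 t2)) \<longleftrightarrow>
    (\<exists>l0 l1 l2. l0 \<noteq> l1 \<and> l1 \<noteq> l2 \<and> l0 \<noteq> l2 \<and>
      charpoly3 a0 a1 a2 x1 x2 l0 = 0 \<and> charpoly3 a0 a1 a2 x1 x2 l1 = 0 \<and>
      charpoly3 a0 a1 a2 x1 x2 l2 = 0 \<and> (l0 - a2) * (l2 - a2) = - (x1 + x2))"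
    (is "?L \<longleftrightarrow> ?R")
proof -
  note t = leonard_pair_diag3_distinct[OF assms] and x = leonard_pair_tridiag3_offdiag[OF assms]
    and rel = bipartite_leonard_pair_relation[OF assms]
  note form = form3_eigvec3_diag3_eq_0_iff[OF x(1) t(1) rel(2)]
  show ?thesis
  proof
    assume ?L
    from leonard_pair_imp_roots[OF this] form show ?R by metis
  next
    assume ?R
    then show ?L using roots_imp_leonard_pair[OF x t(2,3)] form by metis
  qed
qed

text \<open>The root \<open>l1\<close> is \<open>a2\<close> if \<open>a0 = a2\<close> and
  \<open>a1\<close> otherwise; \<open>l0\<close> and \<open>l2\<close> are the roots of
  \<open>(z - a0) * (z - c) - (x1 + x2)\<close>, with \<open>c\<close> the other one of
  \<open>a1\<close> and \<open>a2\<close>. The conditions with factor 4 say that its discriminant is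
  nonzero, the cubic one that \<open>a1\<close> is not among its roots. If \<open>l1 = a2\<close>,
  the nonzero product separates \<open>l1\<close> from \<open>l0\<close> and
  \<open>l2\<close>.\<close>

lemma distinct_roots_iff_coeffs:
  fixes a0 a1 a2 x1 x2 t0 t1 t2 :: "'a::alg_closed_field"
  assumes char: "CHAR('a) \<noteq> 2"
    and x: "x1 \<noteq> 0" "x2 \<noteq> 0" and S: "x1 + x2 \<noteq> 0"
    and t: "t0 \<noteq> t2" and rel: "x1 * (t0 - t1) = x2 * (t1 - t2)"
  shows "(\<exists>l0 l1 l2. l0 \<noteq> l1 \<and> l1 \<noteq> l2 \<and> l0 \<noteq> l2 \<and>
      charpoly3 a0 a1 a2 x1 x2 l0 = 0 \<and> charpoly3 a0 a1 a2 x1 x2 l1 = 0 \<and>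
      charpoly3 a0 a1 a2 x1 x2 l2 = 0 \<and> (l0 - a2) * (l2 - a2) = - (x1 + x2)) \<longleftrightarrow>
    (a0 = a2 \<and> (a0 - a1)\<^sup>2 + 4 * (x1 + x2) \<noteq> 0) \<or>
    (a0 \<noteq> a2 \<and> a0 * (t0 - t1) + a2 * (t1 - t2) + a1 * (t2 - t0) = 0 \<and>
     (a0 - a2)\<^sup>2 + 4 * (x1 + x2) \<noteq> 0 \<and> (a0 - a2)\<^sup>2 + (x1 + x2) ^ 3 / (x1 * x2) \<noteq> 0)"
    (is "?L \<longleftrightarrow> ?R")
proof -
  let ?p = "charpoly3 a0 a1 a2 x1 x2"
  \<comment> \<open>\<open>x1 : x2 : x1 + x2\<close> equals \<open>t1 - t2 : t0 - t1 : t0 - t2\<close>.\<close>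
  have "(x1 + x2) * (a0 * (t0 - t1) + a2 * (t1 - t2) + a1 * (t2 - t0)) =
      (t0 - t2) * (x2 * a0 + x1 * a2 - (x1 + x2) * a1)
      + (a0 - a2) * (x1 * (t0 - t1) - x2 * (t1 - t2))"
    by (simp add: algebra_simps)
  then have "(x1 + x2) * (a0 * (t0 - t1) + a2 * (t1 - t2) + a1 * (t2 - t0)) =
      (t0 - t2) * (x2 * a0 + x1 * a2 - (x1 + x2) * a1)"
    unfolding rel by simp
  then have lin: "a0 * (t0 - t1) + a2 * (t1 - t2) + a1 * (t2 - t0) = 0 \<longleftrightarrow>
      (x1 + x2) * a1 = x1 * a2 + x2 * a0"
    using S t by (metis add.commute eq_iff_diff_eq_0 mult_eq_0_iff)
  \<comment> \<open>The value of the quadratic factor at \<open>a1\<close>, multiplied by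
    \<open>(x1 + x2)\<^sup>2\<close> to clear the denominators of \<open>a1\<close>.\<close>
  have res: "(x1 + x2)\<^sup>2 * ((a1 - a0) * (a1 - a2) - (x1 + x2)) =
      - (x1 * x2) * ((a0 - a2)\<^sup>2 + (x1 + x2) ^ 3 / (x1 * x2))"
    if "(x1 + x2) * a1 = x1 * a2 + x2 * a0"
  proof -
    have "(x1 + x2) * (a1 - a0) = x1 * (a2 - a0)" "(x1 + x2) * (a1 - a2) = x2 * (a0 - a2)"
      using that by (simp_all add: algebra_simps)
    then have "((x1 + x2) * (a1 - a0)) * ((x1 + x2) * (a1 - a2)) = x1 * (a2 - a0) * (x2 * (a0 - a2))"
      by simp
    then have "(x1 + x2)\<^sup>2 * ((a1 - a0) * (a1 - a2) - (x1 + x2)) = - (x1 * x2) * (a0 - a2)\<^sup>2 - (x1 + x2) ^ 3"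
      by (simp add: power2_eq_square power3_eq_cube algebra_simps)
    then show ?thesis using x by (simp add: distrib_left)
  qed
  have resne: "(a1 - a0) * (a1 - a2) - (x1 + x2) \<noteq> 0 \<longleftrightarrow>
      (a0 - a2)\<^sup>2 + (x1 + x2) ^ 3 / (x1 * x2) \<noteq> 0"
    if "(x1 + x2) * a1 = x1 * a2 + x2 * a0"
    using res[OF that] S x by (metis mult_eq_0_iff neg_equal_0_iff_equal power_not_zero)
  have quadratic: "\<exists>l m. l \<noteq> m \<and> (\<forall>z. (z - l) * (z - m) = (z - a0) * (z - c) - (x1 + x2))"
    if "(a0 - c)\<^sup>2 + 4 * (x1 + x2) \<noteq> 0" for c
  proof -
    have "(a0 + c)\<^sup>2 - 4 * (a0 * c - (x1 + x2)) = (a0 - c)\<^sup>2 + 4 * (x1 + x2)"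
      by (simp add: power2_eq_square algebra_simps)
    with that have "(a0 + c)\<^sup>2 - 4 * (a0 * c - (x1 + x2)) \<noteq> 0"
      by metis
    then obtain l m where "l \<noteq> m" and lm: "l + m = a0 + c" "l * m = a0 * c - (x1 + x2)"
      by (rule quadratic_distinct_roots[OF char])
    have "(z - l) * (z - m) = (z - a0) * (z - c) - (x1 + x2)" for z
    proof -
      have "(z - l) * (z - m) = z * z - (l + m) * z + l * m" by (simp add: algebra_simps)
      then show ?thesis unfolding lm by (simp add: algebra_simps)
    qed
    with \<open>l \<noteq> m\<close> show ?thesis by blast
  qed
  show ?thesis
  proof
    assume ?L
    then obtain l0 l1 l2 where ne: "l0 \<noteq> l1" "l1 \<noteq> l2" "l0 \<noteq> l2"
      and ch: "?p l0 = 0" "?p l1 = 0" "?p l2 = 0"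
      and prod: "(l0 - a2) * (l2 - a2) = - (x1 + x2)" by blast
    note sum = charpoly3_factor(1)[OF ne ch] and fac = charpoly3_factor(2)[OF ne ch]
    \<comment> \<open>The value of \<open>?p\<close> at \<open>a2\<close> is computed twice: from
      the factorisation with \<open>prod\<close>, and from the definition, where it is
      \<open>x2 * (a0 - a2)\<close>.\<close>
    have "(x1 + x2) * (l1 - a2) = ((l0 - a2) * (l2 - a2)) * (a2 - l1)"
      unfolding prod by (simp add: algebra_simps)
    also have "\<dots> = ?p a2"
      unfolding fac by (simp add: algebra_simps)
    finally have n2: "(x1 + x2) * (l1 - a2) = x2 * (a0 - a2)"
      by (simp add: charpoly3_def algebra_simps)
    then have n0: "(x1 + x2) * (l1 - a0) = x1 * (a2 - a0)"
      by (simp add: algebra_simps)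
    \<comment> \<open>The scaling allows \<open>n0\<close> and \<open>n2\<close> to be inserted
      without division.\<close>
    have "(x1 + x2)\<^sup>2 * ?p l1 =
        ((x1 + x2) * (l1 - a0)) * ((l1 - a1) * ((x1 + x2) * (l1 - a2)) - x2 * (x1 + x2))
        - x1 * (x1 + x2) * ((x1 + x2) * (l1 - a2))"
      by (simp add: charpoly3_def power2_eq_square algebra_simps)
    also have "\<dots> = - (x1 * x2 * (a0 - a2)\<^sup>2 * (l1 - a1))"
      unfolding n0 n2 by (simp add: power2_eq_square algebra_simps)
    finally have l1: "a0 = a2 \<or> l1 = a1"
      using ch x by simp
    have sq: "(l0 - l2)\<^sup>2 \<noteq> 0"
      using ne by simp
    have disc: "(l0 - l2)\<^sup>2 = (l0 + l2 - 2 * a2)\<^sup>2 + 4 * (x1 + x2)"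
    proof -
      have "(l0 - l2)\<^sup>2 = (l0 + l2 - 2 * a2)\<^sup>2 - 4 * ((l0 - a2) * (l2 - a2))"
        by (simp add: power2_eq_square algebra_simps)
      then show ?thesis unfolding prod by simp
    qed
    show ?R
    proof (cases "a0 = a2")
      case True
      then have "l1 = a2" using n2 S by simp
      then have "l0 + l2 - 2 * a2 = a1 - a0"
        using sum True by (simp add: algebra_simps)
      then have "(a0 - a1)\<^sup>2 + 4 * (x1 + x2) \<noteq> 0"
        using disc sq by (metis power2_commute)
      then show ?thesis using True by simp
    next
      case False
      then have a1: "l1 = a1" using l1 by simp
      then have "l0 + l2 - 2 * a2 = a0 - a2"
        using sum by (simp add: algebra_simps)
      then have d: "(a0 - a2)\<^sup>2 + 4 * (x1 + x2) \<noteq> 0"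
        using disc sq by metis
      have e: "(x1 + x2) * a1 = x1 * a2 + x2 * a0"
        using n2 a1 by (simp add: algebra_simps)
      have s: "l2 = a0 + a2 - l0"
        using sum a1 by (simp add: algebra_simps)
      have "(a1 - l0) * (a1 - l2) = (a1 - a0) * (a1 - a2) + (l0 - a2) * (l2 - a2)"
        unfolding s by (simp add: algebra_simps)
      then have "(a1 - a0) * (a1 - a2) - (x1 + x2) \<noteq> 0"
        unfolding prod using ne a1 by (metis add_uminus_conv_diff mult_eq_0_iff eq_iff_diff_eq_0)
      then show ?thesis using False d e lin resne by blast
    qed
  next
    assume ?R
    then consider "a0 = a2" "(a0 - a1)\<^sup>2 + 4 * (x1 + x2) \<noteq> 0"
      | "(x1 + x2) * a1 = x1 * a2 + x2 * a0" "(a0 - a2)\<^sup>2 + 4 * (x1 + x2) \<noteq> 0"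
        "(a1 - a0) * (a1 - a2) - (x1 + x2) \<noteq> 0"
      using lin resne by blast
    then show ?L
    proof cases
      case 1
      then obtain l m where "l \<noteq> m" and fac: "(z - l) * (z - m) = (z - a0) * (z - a1) - (x1 + x2)" for z
        using quadratic by blast
      have p: "?p z = (z - a2) * ((z - l) * (z - m))" for z
        unfolding fac using 1(1) by (simp add: charpoly3_def algebra_simps)
      have "(l - a2) * (m - a2) = - (x1 + x2)"
        using fac[of a2] 1(1) by (simp add: algebra_simps)
      moreover from this have "l \<noteq> a2" "a2 \<noteq> m" using S by auto
      ultimately show ?thesis
        using \<open>l \<noteq> m\<close> p by (intro exI[of _ l] exI[of _ a2] exI[of _ m]) simp
    next
      case 2
      then obtain l m where "l \<noteq> m" and fac: "(z - l) * (z - m) = (z - a0) * (z - a2) - (x1 + x2)" for z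
        using quadratic by blast
      have p: "?p z = (z - a1) * ((z - l) * (z - m))" for z
      proof -
        \<comment> \<open>Division of \<open>?p\<close> by \<open>z - a1\<close>; the remainder is
          zero by the linear condition of this case.\<close>
        have "?p z = (z - a1) * ((z - a0) * (z - a2) - (x1 + x2)) + (x1 * a2 + x2 * a0 - (x1 + x2) * a1)"
          by (simp add: charpoly3_def algebra_simps)
        then show ?thesis unfolding fac 2(1) by simp
      qed
      have "(l - a2) * (m - a2) = - (x1 + x2)"
        using fac[of a2] by (simp add: algebra_simps)
      moreover have "l \<noteq> a1" "a1 \<noteq> m" using fac[of a1] 2(3) by auto
      ultimately show ?thesis
        using \<open>l \<noteq> m\<close> p by (intro exI[of _ l] exI[of _ a1] exI[of _ m]) simp
    qed
  qed
qed

theorem proposition11p5: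
  fixes a\<^sub>0 a\<^sub>1 a\<^sub>2 x\<^sub>1 x\<^sub>2 t\<^sub>0 t\<^sub>1 t\<^sub>2 :: "'a::alg_closed_field"
    and A B As :: "'a ^ 3 ^ 3"
  assumes char: "CHAR('a) \<noteq> 2"
    and A: "A = vector [vector [a\<^sub>0, x\<^sub>1, 0],
                        vector [1, a\<^sub>1, x\<^sub>2],
                        vector [0, 1, a\<^sub>2]]"
    and B: "B = vector [vector [0, x\<^sub>1, 0],
                        vector [1, 0, x\<^sub>2],
                        vector [0, 1, 0]]"
    and As: "As = vector [vector [t\<^sub>0, 0, 0],
                          vector [0, t\<^sub>1, 0],
                          vector [0, 0, t\<^sub>2]]"
    and leonard: "vec.leonard_pair 2 ((*v) B) ((*v) As)"
  shows "vec.near_bipartite_expansion 2 ((*v) A) ((*v) B) ((*v) As) \<longleftrightarrow>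
    (a\<^sub>0 = a\<^sub>2 \<and> (a\<^sub>0 - a\<^sub>1)\<^sup>2 + 4 * (x\<^sub>1 + x\<^sub>2) \<noteq> 0) \<or>
    (a\<^sub>0 \<noteq> a\<^sub>2 \<and>
     a\<^sub>0 * (t\<^sub>0 - t\<^sub>1) + a\<^sub>2 * (t\<^sub>1 - t\<^sub>2) + a\<^sub>1 * (t\<^sub>2 - t\<^sub>0) = 0 \<and>
     (a\<^sub>0 - a\<^sub>2)\<^sup>2 + 4 * (x\<^sub>1 + x\<^sub>2) \<noteq> 0 \<and>
     (a\<^sub>0 - a\<^sub>2)\<^sup>2 + (x\<^sub>1 + x\<^sub>2) ^ 3 / (x\<^sub>1 * x\<^sub>2) \<noteq> 0)"
proof -
  have M: "A = tridiag3 a\<^sub>0 a\<^sub>1 a\<^sub>2 x\<^sub>1 x\<^sub>2" "B = tridiag3 0 0 0 x\<^sub>1 x\<^sub>2" "As = diag3 t\<^sub>0 t\<^sub>1 t\<^sub>2"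
    by (simp_all add: A B As tridiag3_def diag3_def)
  note L = leonard[unfolded M]
  show ?thesis
    unfolding M near_bipartite_expansion_tridiag3_iff[OF L] leonard_pair_tridiag3_iff_roots[OF L]
    by (intro distinct_roots_iff_coeffs char leonard_pair_tridiag3_offdiag[OF L]
        bipartite_leonard_pair_relation[OF L] leonard_pair_diag3_distinct[OF L])
qed

end
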